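(* Let $D>0$, $C>0$, and $0\le\rho<\rho'<1$. Suppose a sign vector $y\in\{-1,1\}^n$ at nodes $x=(x_1,\dots,x_n)\in[-1,1]^n$ has the property that every $P\in\mathbb C[X]$ with $\deg P\le D$ and $\|P\|_{[-1,1]}\le C$ has at least $q$ errors greater than $\rho'$, that is, $E_{\rho'}(P;x,y)\ge q$. Then the same vector has at least $q$ errors greater than $\rho$ at every node array $z=(z_1,\dots,z_n)\in[-1,1]^n$ satisfying $$\max_i d_{\mathrm{ang}}(x_i,z_i)\le\frac{\rho'-\rho}{eCD};$$ that is, $E_\rho(P;z,y)\ge q$ simultaneously for all such arrays $z$ and all $P\in\mathbb C[X]$ with $\deg P\le D$ and $\|P\|_{[-1,1]}\le C$.
   Context: $\|P\|_{[-1,1]}=\max_{-1\le t\le1}|P(t)|$; $\deg 0=-\infty$. Node vectors may have repeated entries; counts refer to indices. For $x,y\in[-1,1]^n$ and $\rho\ge0$, $E_\rho(P;x,y):=\#\{i\in\{1,\dots,n\}:|P(x_i)-y_i|>\rho\}$. The angular distance is $d_{\mathrm{ang}}(x,z)=|\arccos x-\arccos z|$ for $x,z\in[-1,1]$. Here $e$ is the base of the natural logarithm. *)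

theory Defs
  imports "HOL-Analysis.Analysis" "HOL-Computational_Algebra.Polynomial"
begin

text \<open>The supremum below is attained (continuity on a compact interval), so it is the maximum.\<close>

definition sup_norm_poly :: "complex poly \<Rightarrow> real" where
  "sup_norm_poly P = (SUP t\<in>{-1..1::real}. norm (poly P (complex_of_real t)))"

text \<open>Vectors of length \<open>n\<close> are functions on \<open>nat\<close> of which only the values on \<open>{1..n}\<close> matter.\<close>

definition num_errors ::
  "nat \<Rightarrow> real \<Rightarrow> complex poly \<Rightarrow> (nat \<Rightarrow> real) \<Rightarrow> (nat \<Rightarrow> real) \<Rightarrow> nat" where
  "num_errors n \<rho> P x y =
     card {i \<in> {1..n}. norm (poly P (complex_of_real (x i)) - complex_of_real (y i)) > \<rho>}"

definition ang_dist :: "real \<Rightarrow> real \<Rightarrow> real" where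
  "ang_dist x z = \<bar>arccos x - arccos z\<bar>"

end

theory Submission
  imports Defs "HOL-Complex_Analysis.Complex_Analysis"
begin

text \<open>The trigonometric polynomial \<open>f \<zeta> = P (cos \<zeta>)\<close> is entire, and the maximum
  modulus principle for \<open>w ^ d * P ((w + 1/w) / 2)\<close> on the unit disc, with \<open>w = exp (\<i> \<zeta>)\<close>,
  gives \<open>\<bar>f \<zeta>\<bar> \<le> C * exp (d * \<bar>Im \<zeta>\<bar>)\<close>. Cauchy's inequality on a disc of radius \<open>1 / d\<close>
  then bounds \<open>f'\<close> by \<open>exp 1 * C * d\<close> on the real line: a Bernstein inequality that is
  weaker than the sharp one by the factor \<open>e\<close>. So moving a node by an angle of at most
  \<open>(\<rho>' - \<rho>) / (exp 1 * C * D)\<close> changes the value there by at most \<open>\<rho>' - \<rho>\<close>.\<close>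

lemma norm_poly_le_sup_norm_poly:
  assumes "t \<in> {-1..1}"
  shows "norm (poly P (complex_of_real t)) \<le> sup_norm_poly P"
  unfolding sup_norm_poly_def
proof (rule cSUP_upper[OF assms])
  have "compact ((\<lambda>t::real. norm (poly P (complex_of_real t))) ` {-1..1})"
    by (intro compact_continuous_image continuous_intros compact_Icc)
  then show "bdd_above ((\<lambda>t::real. norm (poly P (complex_of_real t))) ` {-1..1})"
    by (intro bounded_imp_bdd_above compact_imp_bounded)
qed

lemma sup_norm_poly_nonneg: "0 \<le> sup_norm_poly P"
  by (rule order_trans[OF norm_ge_zero norm_poly_le_sup_norm_poly[of 0]]) simp

text \<open>Each factor \<open>(w + inverse w) / 2\<close> absorbs one power of \<open>w\<close>,
  and \<open>w ^ degree P\<close> supplies enough of them. The left side is a polynomial in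
  \<open>w\<close>, so the singularity at the origin is removable.\<close>

lemma joukowski_polynomial:
  fixes w :: complex
  assumes "w \<noteq> 0"
  shows "(\<Sum>k\<le>degree P. coeff P k * w ^ (degree P - k) * ((w\<^sup>2 + 1) / 2) ^ k)
         = w ^ degree P * poly P ((w + inverse w) / 2)"
proof -
  have "w ^ (degree P - k) * ((w\<^sup>2 + 1) / 2) ^ k = w ^ degree P * ((w + inverse w) / 2) ^ k"
    if "k \<le> degree P" for k
  proof -
    have "(w\<^sup>2 + 1) / 2 = w * ((w + inverse w) / 2)"
      using assms by (simp add: field_simps power2_eq_square)
    then have "w ^ (degree P - k) * ((w\<^sup>2 + 1) / 2) ^ k
               = (w ^ (degree P - k) * w ^ k) * ((w + inverse w) / 2) ^ k"
      by (simp only: power_mult_distrib mult.assoc)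
    then show ?thesis
      using that by (simp add: power_add[symmetric])
  qed
  then have "(\<Sum>k\<le>degree P. coeff P k * (w ^ (degree P - k) * ((w\<^sup>2 + 1) / 2) ^ k))
             = (\<Sum>k\<le>degree P. coeff P k * (w ^ degree P * ((w + inverse w) / 2) ^ k))"
    by (intro sum.cong refl) (simp only: atMost_iff)
  then show ?thesis
    by (simp only: poly_altdef sum_distrib_left mult.assoc mult.left_commute)
qed

text \<open>By the maximum modulus principle only the unit circle matters. There
  \<open>inverse u\<close> is the conjugate of \<open>u\<close>, so \<open>P\<close> is evaluated at
  \<open>Re u\<close>, a point of the interval on which \<open>sup_norm_poly P\<close> is
  taken.\<close>

lemma norm_poly_joukowski_le:
  fixes w :: complex
  assumes "w \<noteq> 0" "norm w \<le> 1"
  shows "norm w ^ degree P * norm (poly P ((w + inverse w) / 2)) \<le> sup_norm_poly P"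
proof -
  \<comment> \<open>Since \<open>inverse 0 = 0\<close>, the product form would drop to 0 at the
    origin when the degree is positive. The sum gives the holomorphic extension instead.\<close>
  define g where
    "g = (\<lambda>w. \<Sum>k\<le>degree P. coeff P k * w ^ (degree P - k) * ((w\<^sup>2 + 1) / 2) ^ k)"
  have g: "g w = w ^ degree P * poly P ((w + inverse w) / 2)" if "w \<noteq> 0" for w
    unfolding g_def by (rule joukowski_polynomial[OF that])
  have "norm (g w) \<le> sup_norm_poly P"
  proof (rule maximum_modulus_frontier[where S = "cball 0 1" and f = g])
    show "g holomorphic_on interior (cball 0 1)" "continuous_on (closure (cball 0 1)) g"
      unfolding g_def by (intro holomorphic_intros continuous_intros; simp)+
    show "norm (g u) \<le> sup_norm_poly P" if "u \<in> frontier (cball 0 1)" for u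
    proof -
      have u: "norm u = 1"
        using that by simp
      then have "inverse u = cnj u"
        using complex_norm_square[of u] u by (intro inverse_unique) simp
      then have "(u + inverse u) / 2 = complex_of_real (Re u)"
        by (simp add: complex_add_cnj)
      moreover have "Re u \<in> {-1..1}"
        using abs_Re_le_cmod[of u] u by auto
      moreover have "u \<noteq> 0"
        using u by auto
      ultimately show ?thesis
        using norm_poly_le_sup_norm_poly[of "Re u" P] u by (simp add: g norm_mult norm_power)
    qed
  qed (use assms in auto)
  then show ?thesis
    using assms by (simp add: g norm_mult norm_power)
qed

text \<open>In the closed upper half plane \<open>w = exp (\<i> * \<zeta>)\<close> lies in the unit
  disc, and dividing the previous bound by \<open>norm w ^ degree P\<close> produces the exponential
  factor.\<close>

lemma norm_poly_cos_le:
  fixes \<zeta> :: complex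
  shows "norm (poly P (cos \<zeta>)) \<le> sup_norm_poly P * exp (real (degree P) * \<bar>Im \<zeta>\<bar>)"
proof -
  have *: "norm (poly P (cos \<zeta>)) \<le> sup_norm_poly P * exp (real (degree P) * Im \<zeta>)"
    if "0 \<le> Im \<zeta>" for \<zeta>
  proof -
    have "(exp (\<i> * \<zeta>) + inverse (exp (\<i> * \<zeta>))) / 2 = cos \<zeta>"
      by (simp add: cos_exp_eq exp_minus)
    moreover have "norm (exp (\<i> * \<zeta>)) ^ degree P = exp (- (real (degree P) * Im \<zeta>))"
      by (simp add: norm_exp_eq_Re flip: exp_of_nat_mult)
    moreover have "norm (exp (\<i> * \<zeta>)) \<le> 1"
      using that by (simp add: norm_exp_eq_Re)
    ultimately have "exp (- (real (degree P) * Im \<zeta>)) * norm (poly P (cos \<zeta>)) \<le> sup_norm_poly P"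
      using norm_poly_joukowski_le[of "exp (\<i> * \<zeta>)" P] by (simp only: exp_not_eq_zero) simp
    then show ?thesis
      by (simp add: exp_minus field_simps)
  qed
  show ?thesis
    \<comment> \<open>Cosine is even, so the lower half plane reduces to the upper one.\<close>
    using *[of \<zeta>] *[of "- \<zeta>"] by (cases "0 \<le> Im \<zeta>") auto
qed

lemma holomorphic_on_poly_cos: "(\<lambda>\<zeta>. poly P (cos \<zeta>)) holomorphic_on S"
  unfolding poly_altdef by (intro holomorphic_intros)

lemma norm_deriv_poly_cos_le:
  assumes "\<zeta> \<in> \<real>"
  shows "norm (deriv (\<lambda>\<zeta>. poly P (cos \<zeta>)) \<zeta>) \<le> exp 1 * sup_norm_poly P * real (degree P)"
\<comment> \<open>A constant is treated separately because the radius \<open>1 / d\<close> below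
  needs \<open>d > 0\<close>.\<close>
proof (cases "degree P = 0")
  case True
  then obtain c where "P = [:c:]"
    by (metis degree_eq_zeroE)
  then show ?thesis
    by simp
next
  case False
  define d where "d = real (degree P)"
  have d: "d > 0"
    using False by (simp add: d_def)
  have "norm ((deriv ^^ 1) (\<lambda>\<zeta>. poly P (cos \<zeta>)) \<zeta>)
        \<le> fact 1 * (sup_norm_poly P * exp 1) / (1 / d) ^ 1"
  proof (rule Cauchy_inequality)
    show "(\<lambda>\<zeta>. poly P (cos \<zeta>)) holomorphic_on ball \<zeta> (1 / d)"
      by (rule holomorphic_on_poly_cos)
    show "continuous_on (cball \<zeta> (1 / d)) (\<lambda>\<zeta>. poly P (cos \<zeta>))"
      by (intro continuous_intros)
    fix u assume u: "norm (\<zeta> - u) = 1 / d"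
    \<comment> \<open>As \<zeta> is real, a point at distance \<open>1 / d\<close> from it has
      imaginary part at most \<open>1 / d\<close> in modulus. The growth factor is then at most
      \<open>exp 1\<close>.\<close>
    have "\<bar>Im u\<bar> \<le> 1 / d"
      using abs_Im_le_cmod[of "\<zeta> - u"] assms u by (simp add: complex_is_Real_iff)
    then have "exp (d * \<bar>Im u\<bar>) \<le> exp 1"
      using d by (simp add: field_simps)
    then show "norm (poly P (cos u)) \<le> sup_norm_poly P * exp 1"
      unfolding d_def
      by (rule order_trans[OF norm_poly_cos_le mult_left_mono[OF _ sup_norm_poly_nonneg]])
  qed (use d in auto)
  then show ?thesis
    using d by (simp add: d_def mult_ac)
qed

text \<open>The substitution \<open>s = cos (arccos s)\<close> turns angular distance into ordinary
  distance on the real axis. That axis is convex, so the derivative bound there suffices for the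
  mean value estimate.\<close>

lemma norm_poly_diff_le_ang_dist:
  assumes "s \<in> {-1..1}" "t \<in> {-1..1}"
  shows "norm (poly P (complex_of_real s) - poly P (complex_of_real t))
         \<le> exp 1 * sup_norm_poly P * real (degree P) * ang_dist s t"
proof -
  let ?f = "\<lambda>\<zeta>::complex. poly P (cos \<zeta>)"
  have "?f field_differentiable at \<zeta>" for \<zeta>
    by (rule holomorphic_on_imp_differentiable_at[OF holomorphic_on_poly_cos open_UNIV UNIV_I])
  then have "norm (?f (of_real (arccos s)) - ?f (of_real (arccos t)))
        \<le> exp 1 * sup_norm_poly P * real (degree P)
           * norm (complex_of_real (arccos s) - complex_of_real (arccos t))"
    by (intro field_differentiable_bound[where S = \<real> and f' = "deriv ?f"])
      (auto intro: convex_Reals norm_deriv_poly_cos_le has_field_derivative_at_within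
        simp: field_differentiable_derivI)
  then show ?thesis
    using assms by (simp add: ang_dist_def cos_of_real flip: of_real_diff)
qed

theorem proposition7p3:
  fixes D C \<rho> \<rho>' :: real
    and n q :: nat
    and x y :: "nat \<Rightarrow> real"
  assumes "D > 0" and "C > 0"
    and "0 \<le> \<rho>" and "\<rho> < \<rho>'" and "\<rho>' < 1"
    and "\<forall>i\<in>{1..n}. x i \<in> {-1..1}"
    and "\<forall>i\<in>{1..n}. y i \<in> {-1, 1}"
    and "\<forall>P :: complex poly. real (degree P) \<le> D \<and> sup_norm_poly P \<le> C
           \<longrightarrow> num_errors n \<rho>' P x y \<ge> q"
  shows "\<forall>z :: nat \<Rightarrow> real.
           (\<forall>i\<in>{1..n}. z i \<in> {-1..1}) \<and>
           (\<forall>i\<in>{1..n}. ang_dist (x i) (z i) \<le> (\<rho>' - \<rho>) / (exp 1 * C * D))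
           \<longrightarrow> (\<forall>P :: complex poly. real (degree P) \<le> D \<and> sup_norm_poly P \<le> C
                 \<longrightarrow> num_errors n \<rho> P z y \<ge> q)"
proof (intro allI impI, elim conjE)
  fix z :: "nat \<Rightarrow> real" and P :: "complex poly"
  assume z: "\<forall>i\<in>{1..n}. z i \<in> {-1..1}"
    and dist: "\<forall>i\<in>{1..n}. ang_dist (x i) (z i) \<le> (\<rho>' - \<rho>) / (exp 1 * C * D)"
    and P: "real (degree P) \<le> D" "sup_norm_poly P \<le> C"
  have close: "norm (poly P (complex_of_real (x i)) - poly P (complex_of_real (z i))) \<le> \<rho>' - \<rho>"
    if i: "i \<in> {1..n}" for i
  proof -
    have "norm (poly P (complex_of_real (x i)) - poly P (complex_of_real (z i)))
          \<le> exp 1 * sup_norm_poly P * real (degree P) * ang_dist (x i) (z i)"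
      using assms(6) z i by (intro norm_poly_diff_le_ang_dist) auto
    \<comment> \<open>The Lipschitz constant is at most \<open>exp 1 * C * D\<close>, which is
      exactly the denominator in the allowed angular displacement.\<close>
    also have "\<dots> \<le> exp 1 * C * D * ((\<rho>' - \<rho>) / (exp 1 * C * D))"
      using P dist i assms(1,2) by (intro mult_mono) (auto simp: ang_dist_def sup_norm_poly_nonneg)
    also have "\<dots> = \<rho>' - \<rho>"
      using assms(1,2) by simp
    finally show ?thesis .
  qed
  have "q \<le> num_errors n \<rho>' P x y"
    using assms(8) P by blast
  \<comment> \<open>For the same \<open>P\<close>, every index with error above
    \<open>\<rho>'\<close> at \<open>x\<close> has error above \<open>\<rho>\<close> at
    \<open>z\<close>: by the triangle inequality the error drops by at most
    \<open>\<rho>' - \<rho>\<close>.\<close>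
  also have "\<dots> \<le> num_errors n \<rho> P z y"
    unfolding num_errors_def
  proof (intro card_mono subsetI)
    fix i
    assume "i \<in> {i \<in> {1..n}. \<rho>' < norm (poly P (complex_of_real (x i)) - complex_of_real (y i))}"
    then have i: "i \<in> {1..n}"
      and "\<rho>' < norm (poly P (complex_of_real (x i)) - complex_of_real (y i))"
      by auto
    then have "\<rho> < norm (poly P (complex_of_real (z i)) - complex_of_real (y i))"
      using close[OF i]
        norm_triangle_ineq[of "poly P (complex_of_real (x i)) - poly P (complex_of_real (z i))"
          "poly P (complex_of_real (z i)) - complex_of_real (y i)"]
      by simp
    with i show "i \<in> {i \<in> {1..n}. \<rho> < norm (poly P (complex_of_real (z i)) - complex_of_real (y i))}"
      by simp
  qed simp
  finally show "q \<le> num_errors n \<rho> P z y" .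
qed

end
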